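(* Let $G$ be a countable discrete group with identity element $e$. Let $0\le\tau<1$ and $0<\eta<1$. Then there are an $\ell\in\mathbb N$ and $\eta',\eta''>0$ such that, whenever $e\in F_1\subseteq F_2\subseteq\cdots\subseteq F_\ell$ are finite subsets of $G$ with $|(F_{k-1}^{-1}F_k)\setminus F_k|\le\eta'|F_k|$ for $k=2,\dots,\ell$, there exists a finite set $F\subseteq G$ containing $e$ such that for every $d\in\mathbb N$, every map $\sigma:G\to\mathrm{Sym}(d)$ with a set $B\subseteq\{1,\dots,d\}$ satisfying $|B|\ge(1-\eta'')d$ and $$\sigma_{st}(a)=\sigma_s\sigma_t(a),\quad \sigma_s(a)\ne\sigma_{s'}(a),\quad \sigma_e(a)=a$$ for all $a\in B$ and $s,t,s'\in F$ with $s\ne s'$, and any set $V\subseteq\{1,\dots,d\}$ with $|V|\ge(1-\tau)d$, there exist $C_1,\dots,C_\ell\subseteq V$ such that (i) for every $k=1,\dots,\ell$ and $c\in C_k$, the map $s\mapsto\sigma_s(c)$ from $F_k$ to $\sigma(F_k)c$ is bijective; (ii) the sets $\sigma(F_1)C_1,\dots,\sigma(F_\ell)C_\ell$ are pairwise disjoint, and the family $\bigcup_{k=1}^\ell\{\sigma(F_k)c:c\in C_k\}$ is $\eta$-disjoint and $(1-\tau-\eta)$-covers $\{1,\dots,d\}$.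
   Context: $\mathrm{Sym}(d)$ is the group of permutations of $\{1,\dots,d\}$; a map $\sigma:G\to\mathrm{Sym}(d)$, $s\mapsto\sigma_s$, is not assumed to be a homomorphism. For $A\subseteq G$ and $C\subseteq\{1,\dots,d\}$, $\sigma(A)c=\{\sigma_s(c):s\in A\}$ and $\sigma(A)C=\{\sigma_s(c):s\in A,c\in C\}$. For $A,B\subseteq G$, $A^{-1}B=\{a^{-1}b:a\in A,b\in B\}$. A family of subsets of $\{1,\dots,d\}$ (with counting measure) $\delta$-covers $\{1,\dots,d\}$ if its union has cardinality at least $\delta d$. A family $\{A_i\}_{i\in I}$ of nonempty subsets of $\{1,\dots,d\}$ is $\varepsilon$-disjoint if there are pairwise disjoint sets $\widehat A_i\subseteq A_i$ ($i\in I$) with $|\widehat A_i|\ge(1-\varepsilon)|A_i|$ for all $i\in I$. The family in (ii) is understood as indexed by the pairs $(k,c)$ with $1\le k\le\ell$ and $c\in C_k$. *)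

theory Defs
  imports "HOL-Algebra.Sym_Groups" "HOL-Library.Countable_Set" "HOL-Library.Disjoint_Sets"
    Complex_Main
begin

text \<open>For a (not necessarily multiplicative) map \<open>\<sigma> : G \<rightarrow> Sym(d)\<close>: the sets
  \<open>\<sigma>(A)c\<close> and \<open>\<sigma>(A)C\<close>.\<close>

definition img_pt :: "('g \<Rightarrow> nat \<Rightarrow> nat) \<Rightarrow> 'g set \<Rightarrow> nat \<Rightarrow> nat set" where
  "img_pt \<sigma> A c = {\<sigma> s c | s. s \<in> A}"

definition img_set :: "('g \<Rightarrow> nat \<Rightarrow> nat) \<Rightarrow> 'g set \<Rightarrow> nat set \<Rightarrow> nat set" where
  "img_set \<sigma> A C = {\<sigma> s c | s c. s \<in> A \<and> c \<in> C}"

text \<open>Both notions concern indexed families \<open>(A i)\<close>, \<open>i \<in> I\<close>, of subsets of \<open>{1..d}\<close>;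
  being such a family (of nonempty sets, for \<open>\<epsilon>\<close>-disjointness) is part of the definition.\<close>

definition delta_covers :: "nat \<Rightarrow> real \<Rightarrow> 'i set \<Rightarrow> ('i \<Rightarrow> nat set) \<Rightarrow> bool" where
  "delta_covers d \<delta> I A \<longleftrightarrow>
     (\<forall>i\<in>I. A i \<subseteq> {1..d}) \<and> real (card (\<Union>i\<in>I. A i)) \<ge> \<delta> * real d"

definition eps_disjoint :: "nat \<Rightarrow> real \<Rightarrow> 'i set \<Rightarrow> ('i \<Rightarrow> nat set) \<Rightarrow> bool" where
  "eps_disjoint d \<epsilon> I A \<longleftrightarrow>
     (\<forall>i\<in>I. A i \<subseteq> {1..d} \<and> A i \<noteq> {}) \<and>
     (\<exists>A'. (\<forall>i\<in>I. A' i \<subseteq> A i) \<and> disjoint_family_on A' I \<and>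
           (\<forall>i\<in>I. real (card (A' i)) \<ge> (1 - \<epsilon>) * real (card (A i))))"

end

theory Submission
  imports Defs
begin

text \<open>The sets \<open>C l, \<dots>, C 1\<close> are chosen greedily, from the largest shape down. At level \<open>k\<close> let \<open>D\<close> be
  the part already covered, and let \<open>W\<close> be the set of \<open>c \<in> V \<inter> B\<close> whose tile \<open>\<sigma>(F k)c\<close> misses \<open>D\<close>.
  A maximal \<open>\<eta>\<close>-disjoint family of tiles with centres in \<open>W\<close> covers at least \<open>\<eta> |W|\<close> points, by
  double counting. If the tile of \<open>c\<close> meets \<open>\<sigma>(F j)b\<close> with \<open>j > k\<close>, then
  \<open>c \<in> \<sigma>(F (j - 1)\<^sup>-\<^sup>1 F j)b\<close>, so almost invariance makes \<open>|W|\<close> at least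
  \<open>|V \<inter> B| - |D| - \<eta>' d / (1 - \<eta>)\<close>. Hence the uncovered part of \<open>V \<inter> B\<close> shrinks by the factor
  \<open>1 - \<eta>\<close> at each level, up to a small error.\<close>

section \<open>Gluing, reindexing and total size of \<open>\<epsilon>\<close>-disjoint
  families\<close>

lemma eps_disjoint_Un:
  assumes I: "eps_disjoint d \<epsilon> I A" and J: "eps_disjoint d \<epsilon> J A"
    and dis: "(\<Union>i\<in>I. A i) \<inter> (\<Union>i\<in>J. A i) = {}"
  shows "eps_disjoint d \<epsilon> (I \<union> J) A"
proof -
  obtain A1 where A1: "\<forall>i\<in>I. A1 i \<subseteq> A i" "disjoint_family_on A1 I"
    "\<forall>i\<in>I. real (card (A1 i)) \<ge> (1 - \<epsilon>) * real (card (A i))"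
    using I unfolding eps_disjoint_def by blast
  obtain A2 where A2: "\<forall>i\<in>J. A2 i \<subseteq> A i" "disjoint_family_on A2 J"
    "\<forall>i\<in>J. real (card (A2 i)) \<ge> (1 - \<epsilon>) * real (card (A i))"
    using J unfolding eps_disjoint_def by blast
  define A' where "A' i = (if i \<in> I then A1 i else A2 i)" for i
  have "A' i \<inter> A' j = {}" if ij: "i \<in> I \<union> J" "j \<in> I \<union> J" "i \<noteq> j" for i j
  proof -
    consider "i \<in> I" "j \<in> I" | "i \<in> I" "j \<notin> I" "j \<in> J" | "i \<notin> I" "i \<in> J" "j \<in> I"
      | "i \<notin> I" "j \<notin> I" "i \<in> J" "j \<in> J" using ij by blast
    then show ?thesis
    proof cases
      case 1
      then show ?thesis using A1(2) ij(3) by (simp add: A'_def disjoint_family_on_def)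
    next
      case 2
      then show ?thesis using A1(1) A2(1) dis unfolding A'_def by auto blast
    next
      case 3
      then show ?thesis using A1(1) A2(1) dis unfolding A'_def by auto blast
    next
      case 4
      then show ?thesis using A2(2) ij(3) by (simp add: A'_def disjoint_family_on_def)
    qed
  qed
  then have "disjoint_family_on A' (I \<union> J)" by (simp add: disjoint_family_on_def)
  moreover have "\<forall>i\<in>I \<union> J. A' i \<subseteq> A i"
    using A1(1) A2(1) by (auto simp: A'_def)
  moreover have "\<forall>i\<in>I \<union> J. real (card (A' i)) \<ge> (1 - \<epsilon>) * real (card (A i))"
    using A1(3) A2(3) by (auto simp: A'_def)
  ultimately show ?thesis
    using I J unfolding eps_disjoint_def by (metis Un_iff)
qed

text \<open>Serves to relabel the tiles of one level, indexed by their centres, by pairs of level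
  and centre; injectivity of \<open>f\<close> lets the disjoint cores be carried along.\<close>

lemma eps_disjoint_image:
  assumes "eps_disjoint d \<epsilon> I (A \<circ> f)" and "inj_on f I"
  shows "eps_disjoint d \<epsilon> (f ` I) A"
proof -
  obtain A' where A': "\<forall>i\<in>I. A' i \<subseteq> A (f i)" "disjoint_family_on A' I"
    "\<forall>i\<in>I. real (card (A' i)) \<ge> (1 - \<epsilon>) * real (card (A (f i)))"
    using assms(1) unfolding eps_disjoint_def by auto
  have "disjoint_family_on (A' \<circ> inv_into I f) (f ` I)"
    using A'(2) assms(2) unfolding disjoint_family_on_def
    by (metis (no_types, lifting) comp_apply imageE inv_into_f_f)
  then show ?thesis
    using A' assms unfolding eps_disjoint_def
    by (intro conjI exI[of _ "A' \<circ> inv_into I f"]) auto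
qed

text \<open>The disjoint cores lie in \<open>{1..d}\<close>, so their sizes add up to at most
  \<open>d\<close>, and each core keeps a fraction at least \<open>1 - \<epsilon>\<close> of its
  set. This later bounds an error summed over all tiles already placed.\<close>

lemma eps_disjoint_sum_card_le:
  assumes "eps_disjoint d \<epsilon> I A" and "finite I"
  shows "(1 - \<epsilon>) * (\<Sum>i\<in>I. real (card (A i))) \<le> real d"
proof -
  have sub: "\<forall>i\<in>I. A i \<subseteq> {1..d}" using assms(1) unfolding eps_disjoint_def by blast
  obtain A' where A': "\<forall>i\<in>I. A' i \<subseteq> A i" "disjoint_family_on A' I"
    "\<forall>i\<in>I. real (card (A' i)) \<ge> (1 - \<epsilon>) * real (card (A i))"
    using assms(1) unfolding eps_disjoint_def by blast
  have sub': "A' i \<subseteq> {1..d}" if "i \<in> I" for i using that sub A'(1) by blast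
  have "(1 - \<epsilon>) * (\<Sum>i\<in>I. real (card (A i))) \<le> (\<Sum>i\<in>I. real (card (A' i)))"
    using A'(3) by (simp add: sum_distrib_left sum_mono)
  also have "\<dots> = real (card (\<Union>i\<in>I. A' i))"
    using A'(2) assms(2) sub' finite_subset[of _ "{1..d}"]
    by (subst card_UN_disjoint) (auto simp: disjoint_family_on_def)
  also have "\<dots> \<le> real (card {1..d})"
    using sub' by (intro of_nat_mono card_mono) auto
  finally show ?thesis by simp
qed

section \<open>Choosing tiles level by level\<close>

text \<open>For a maximal subfamily, every tile of \<open>W\<close> has at least
  \<open>\<epsilon> * n\<close> points in the union \<open>E\<close>: otherwise its part outside
  \<open>E\<close> could serve as a further core. So the incidences between centres in
  \<open>W\<close> and points of \<open>E\<close> number at least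
  \<open>\<epsilon> * n * card W\<close>, and at most \<open>n * card E\<close> by
  \<open>mult\<close>. Since \<open>n\<close> is both tile size and multiplicity bound, it
  cancels.\<close>

lemma ex_eps_disjoint_subfamily:
  fixes A :: "nat \<Rightarrow> nat set"
  assumes W: "finite W" and "0 \<le> \<epsilon>" and "\<epsilon> \<le> 1" and n: "0 < n"
    and A: "\<And>c. c \<in> W \<Longrightarrow> A c \<subseteq> {1..d} \<and> card (A c) = n"
    and mult: "\<And>y. card {c\<in>W. y \<in> A c} \<le> n"
  shows "\<exists>C\<subseteq>W. eps_disjoint d \<epsilon> C A \<and> \<epsilon> * real (card W) \<le> real (card (\<Union>c\<in>C. A c))"
proof -
  define S where "S = {C. C \<subseteq> W \<and> eps_disjoint d \<epsilon> C A}"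
  have "finite S" using W by (auto simp: S_def)
  moreover have "{} \<in> S" by (auto simp: S_def eps_disjoint_def disjoint_family_on_def)
  ultimately obtain C where C: "C \<in> S" and max: "\<And>C'. C' \<in> S \<Longrightarrow> C \<subseteq> C' \<Longrightarrow> C' = C"
    using finite_has_maximal[of S] by blast
  define E where "E = (\<Union>c\<in>C. A c)"
  have CW: "C \<subseteq> W" and CA: "eps_disjoint d \<epsilon> C A" using C by (auto simp: S_def)
  have finA: "finite (A c)" if "c \<in> W" for c using A[OF that] finite_subset by blast
  have finE: "finite E" using CW W finA by (auto simp: E_def intro: finite_subset)
  have hit: "\<epsilon> * real n \<le> real (card (A c \<inter> E))" if c: "c \<in> W" for c
  proof (cases "c \<in> C")
    case True
    then have "A c \<inter> E = A c" by (auto simp: E_def)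
    then show ?thesis using A[OF c] \<open>\<epsilon> \<le> 1\<close> by (simp add: mult_left_le_one_le \<open>0 \<le> \<epsilon>\<close>)
  next
    case False
    obtain A' where A': "\<forall>i\<in>C. A' i \<subseteq> A i" "disjoint_family_on A' C"
      "\<forall>i\<in>C. real (card (A' i)) \<ge> (1 - \<epsilon>) * real (card (A i))"
      using CA unfolding eps_disjoint_def by blast
    show ?thesis
    proof (rule ccontr)
      assume small: "\<not> ?thesis"
      have "card (A c) = card (A c \<inter> E) + card (A c - E)"
        using card_Int_Diff finA c by blast
      then have big: "real (card (A c - E)) \<ge> (1 - \<epsilon>) * real (card (A c))"
        using small A[OF c] by (simp add: algebra_simps)
      \<comment> \<open>The old cores lie in \<open>E\<close>, hence miss the new core
        \<open>A c - E\<close>.\<close>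
      have "disjoint_family_on (A'(c := A c - E)) (insert c C)"
        using A'(1,2) False unfolding disjoint_family_on_def E_def
        by (auto; blast)
      moreover have "\<forall>i\<in>insert c C. A i \<subseteq> {1..d} \<and> A i \<noteq> {}"
        using A CW c n by (metis card.empty insert_iff less_irrefl subsetD)
      ultimately have "eps_disjoint d \<epsilon> (insert c C) A"
        unfolding eps_disjoint_def using A'(1,3) big
        by (intro conjI exI[of _ "A'(c := A c - E)"]) auto
      then have "insert c C \<in> S" using c CW by (simp add: S_def)
      then show False using max False by blast
    qed
  qed
  have "\<epsilon> * real (card W) * real n = (\<Sum>c\<in>W. \<epsilon> * real n)" by simp
  also have "\<dots> \<le> (\<Sum>c\<in>W. real (card (A c \<inter> E)))" using hit by (intro sum_mono) auto
  also have "\<dots> = real (\<Sum>c\<in>W. card {y\<in>E. y \<in> A c})"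
    by (simp add: Int_def conj_commute)
  also have "\<dots> = real (\<Sum>y\<in>E. card {c\<in>W. y \<in> A c})"
    using sum_multicount_gen[OF W finE, of "\<lambda>c y. y \<in> A c" "\<lambda>y. card {c\<in>W. y \<in> A c}"] by simp
  also have "\<dots> \<le> real (card E * n)"
    using sum_bounded_above[of E "\<lambda>y. card {c\<in>W. y \<in> A c}" n] mult
    by (intro of_nat_mono) simp
  finally have "\<epsilon> * real (card W) \<le> real (card E)" using n by simp
  then show ?thesis using CW CA E_def by blast
qed

text \<open>The group will enter only through \<open>mult\<close> and \<open>hit\<close>. The target
  \<open>v\<close> is \<open>card U\<close> less a bound for the centres lost to boundary effects:
  \<open>\<delta>\<close> times the total tile size, which is at most
  \<open>d / (1 - \<epsilon>)\<close>. Each level multiplies the bound on the deficit of the covered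
  part against \<open>v\<close> by \<open>1 - \<epsilon>\<close>.\<close>

lemma ex_quasitiling:
  fixes A :: "nat \<Rightarrow> nat \<Rightarrow> nat set" and n :: "nat \<Rightarrow> nat"
  assumes U: "U \<subseteq> {1..d}" and \<epsilon>: "0 \<le> \<epsilon>" "\<epsilon> < 1" and \<delta>: "0 \<le> \<delta>"
    and n: "\<And>k. k \<in> {1..l} \<Longrightarrow> 0 < n k"
    and A: "\<And>k c. k \<in> {1..l} \<Longrightarrow> c \<in> U \<Longrightarrow> A k c \<subseteq> {1..d} \<and> card (A k c) = n k"
    and mult: "\<And>k y. k \<in> {1..l} \<Longrightarrow> card {c\<in>U. y \<in> A k c} \<le> n k"
    and hit: "\<And>k j b. k \<in> {1..l} \<Longrightarrow> j \<in> {1..l} \<Longrightarrow> k < j \<Longrightarrow> b \<in> U \<Longrightarrow>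
        real (card ({c\<in>U. A k c \<inter> A j b \<noteq> {}} - A j b)) \<le> \<delta> * real (n j)"
  defines "v \<equiv> real (card U) - \<delta> * real d / (1 - \<epsilon>)"
  shows "\<exists>C. (\<forall>k\<in>{1..l}. C k \<subseteq> U) \<and>
    disjoint_family_on (\<lambda>k. \<Union>c\<in>C k. A k c) {1..l} \<and>
    eps_disjoint d \<epsilon> (SIGMA k:{1..l}. C k) (\<lambda>(k, c). A k c) \<and>
    v - real (card (\<Union>(k, c)\<in>(SIGMA k:{1..l}. C k). A k c)) \<le> (1 - \<epsilon>) ^ l * v"
proof -
  have finU: "finite U" using U finite_subset by blast
  \<comment> \<open>The induction counts levels from the top: \<open>{l-i<..l}\<close> consists of
    the \<open>i\<close> largest indices.\<close>
  have "\<exists>C. (\<forall>k\<in>{l-i<..l}. C k \<subseteq> U) \<and>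
    disjoint_family_on (\<lambda>k. \<Union>c\<in>C k. A k c) {l-i<..l} \<and>
    eps_disjoint d \<epsilon> (SIGMA k:{l-i<..l}. C k) (\<lambda>(k, c). A k c) \<and>
    v - real (card (\<Union>(k, c)\<in>(SIGMA k:{l-i<..l}. C k). A k c)) \<le> (1 - \<epsilon>) ^ i * v"
    if "i \<le> l" for i
    using that
  proof (induction i)
    case 0
    show ?case by (simp add: disjoint_family_on_def eps_disjoint_def)
  next
    case (Suc i)
    \<comment> \<open>Since \<open>Suc i \<le> l\<close>, no subtraction is truncated:
      \<open>k\<close> is at least 1 and is the level just below those already treated.\<close>
    define k where "k = l - i"
    have k: "k \<in> {1..l}" and lev: "{l - Suc i<..l} = insert k {k<..l}"
      using Suc.prems by (auto simp: k_def)
    obtain C where CU: "\<forall>j\<in>{k<..l}. C j \<subseteq> U"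
      and dis: "disjoint_family_on (\<lambda>j. \<Union>c\<in>C j. A j c) {k<..l}"
      and eps: "eps_disjoint d \<epsilon> (SIGMA j:{k<..l}. C j) (\<lambda>(j, c). A j c)"
      and cov: "v - real (card (\<Union>(j, c)\<in>(SIGMA j:{k<..l}. C j). A j c)) \<le> (1 - \<epsilon>) ^ i * v"
      using Suc unfolding k_def by auto
    define I where "I = (SIGMA j:{k<..l}. C j)"
    define D where "D = (\<Union>(j, c)\<in>I. A j c)"
    define W where "W = {c\<in>U. A k c \<inter> D = {}}"
    have finI: "finite I" using CU finU finite_subset unfolding I_def by blast
    have I: "j \<in> {1..l}" "k < j" "b \<in> U" if "(j, b) \<in> I" for j b
      using that CU k by (auto simp: I_def)
    have Dd: "D \<subseteq> {1..d}" using I A by (fastforce simp: D_def)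
    then have finD: "finite D" using finite_subset by blast
    have finW: "finite W" using finU by (simp add: W_def)
    \<comment> \<open>\<open>H (j, b)\<close> collects the centres outside the tile of
      \<open>b\<close> at level \<open>j\<close> whose own level-\<open>k\<close> tile meets it. A
      centre of \<open>U\<close> excluded from \<open>W\<close> thus lies in \<open>D\<close> or in
      some \<open>H p\<close>.\<close>
    define H where "H = (\<lambda>(j, b). {c\<in>U. A k c \<inter> A j b \<noteq> {}} - A j b)"
    have "U \<subseteq> W \<union> D \<union> (\<Union>p\<in>I. H p)"
      by (auto simp: W_def D_def H_def)
    moreover have "finite (\<Union>p\<in>I. H p)" using finI finU by (auto simp: H_def)
    ultimately have "card U \<le> card (W \<union> D \<union> (\<Union>p\<in>I. H p))"
      using finW finD by (intro card_mono) auto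
    also have "\<dots> \<le> card W + card D + card (\<Union>p\<in>I. H p)"
      by (meson add_le_mono card_Un_le le_refl le_trans)
    also have "\<dots> \<le> card W + card D + (\<Sum>p\<in>I. card (H p))"
      using card_UN_le[OF finI] by simp
    finally have "real (card U) \<le> real (card W) + real (card D) + (\<Sum>p\<in>I. real (card (H p)))"
      by (metis of_nat_add of_nat_le_iff of_nat_sum)
    \<comment> \<open>As \<open>n j\<close> is the size of \<open>A j b\<close>, the bounds from
      \<open>hit\<close> become proportional to tile sizes, whose sum is controlled by
      \<open>\<epsilon>\<close>-disjointness.\<close>
    also have "(\<Sum>p\<in>I. real (card (H p))) \<le> (\<Sum>p\<in>I. \<delta> * real (card (case p of (j, b) \<Rightarrow> A j b)))"
      using hit[OF k] I A by (intro sum_mono) (auto simp: H_def)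
    also have "\<dots> = \<delta> * (\<Sum>p\<in>I. real (card (case p of (j, b) \<Rightarrow> A j b)))"
      by (simp add: sum_distrib_left)
    also have "\<dots> \<le> \<delta> * (real d / (1 - \<epsilon>))"
      using eps_disjoint_sum_card_le[OF eps[folded I_def] finI] \<epsilon> \<delta>
      by (intro mult_left_mono) (simp_all add: pos_le_divide_eq mult.commute)
    finally have Wv: "v - real (card D) \<le> real (card W)" by (simp add: v_def)
    have "\<exists>K\<subseteq>W. eps_disjoint d \<epsilon> K (A k) \<and> \<epsilon> * real (card W) \<le> real (card (\<Union>c\<in>K. A k c))"
    proof (rule ex_eps_disjoint_subfamily[OF finW \<epsilon>(1) _ n[OF k]])
      show "card {c\<in>W. y \<in> A k c} \<le> n k" for y
        using mult[OF k, of y] card_mono[of "{c\<in>U. y \<in> A k c}" "{c\<in>W. y \<in> A k c}"] finU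
        by (force simp: W_def)
    qed (use \<epsilon> A[OF k] in \<open>auto simp: W_def\<close>)
    then obtain K where K: "K \<subseteq> W" "eps_disjoint d \<epsilon> K (A k)"
      "\<epsilon> * real (card W) \<le> real (card (\<Union>c\<in>K. A k c))" by blast
    define E where "E = (\<Union>c\<in>K. A k c)"
    \<comment> \<open>Tiles centred in \<open>W\<close> avoid \<open>D\<close>; this gives
      additivity of the covered sizes as well as disjointness of level \<open>k\<close> from all
      higher levels.\<close>
    have DE: "D \<inter> E = {}" using K(1) by (auto simp: E_def W_def)
    have "finite E" using K(1) A[OF k] by (intro finite_subset[of E "{1..d}"]) (auto simp: E_def W_def)
    then have cardDE: "real (card (D \<union> E)) = real (card D) + real (card E)"
      using finD DE by (simp add: card_Un_disjoint)
    define C' where "C' = C(k := K)"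
    have Sig: "(SIGMA j:{l - Suc i<..l}. C' j) = I \<union> Pair k ` K"
      by (auto simp: lev C'_def I_def split: if_splits)
    have E_alt: "(\<Union>p\<in>Pair k ` K. case p of (j, c) \<Rightarrow> A j c) = E" by (simp add: E_def)
    have "eps_disjoint d \<epsilon> (Pair k ` K) (\<lambda>(j, c). A j c)"
      using K(2) by (intro eps_disjoint_image) (simp_all add: comp_def inj_on_def)
    then have eps': "eps_disjoint d \<epsilon> (SIGMA j:{l - Suc i<..l}. C' j) (\<lambda>(j, c). A j c)"
      unfolding Sig using eps DE eps_disjoint_Un[of d \<epsilon> I "\<lambda>(j, c). A j c"] E_alt
      by (simp add: I_def D_def)
    have Dj: "(\<Union>c\<in>C' j. A j c) \<subseteq> D" if "j \<in> {k<..l}" for j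
      using that by (fastforce simp: D_def I_def C'_def)
    have Ek: "(\<Union>c\<in>C' k. A k c) = E" by (simp add: C'_def E_def)
    have dis': "disjoint_family_on (\<lambda>j. \<Union>c\<in>C' j. A j c) {l - Suc i<..l}"
      unfolding lev disjoint_family_on_def
    proof (intro ballI impI)
      fix a b assume ab: "a \<in> insert k {k<..l}" "b \<in> insert k {k<..l}" "a \<noteq> b"
      show "(\<Union>c\<in>C' a. A a c) \<inter> (\<Union>c\<in>C' b. A b c) = {}"
      proof (cases "a = k \<or> b = k")
        case True
        then consider "a = k" "b \<in> {k<..l}" | "b = k" "a \<in> {k<..l}" using ab by blast
        then show ?thesis using Dj Ek DE by cases blast+
      next
        case False
        then show ?thesis using ab dis by (simp add: C'_def disjoint_family_on_def)
      qed
    qed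
    \<comment> \<open>Put \<open>x = v - card D\<close>. The new tiles cover at least
      \<open>\<epsilon> * card W\<close> points and \<open>card W \<ge> x\<close>, so the deficit
      falls to at most \<open>(1 - \<epsilon>) * x\<close>.\<close>
    have "v - real (card (D \<union> E)) \<le> v - real (card D) - \<epsilon> * real (card W)"
      using K(3)[folded E_def] cardDE by linarith
    also have "\<dots> \<le> v - real (card D) - \<epsilon> * (v - real (card D))"
      using mult_left_mono[OF Wv \<epsilon>(1)] by simp
    also have "\<dots> = (1 - \<epsilon>) * (v - real (card D))" by (simp add: algebra_simps)
    also have "\<dots> \<le> (1 - \<epsilon>) * ((1 - \<epsilon>) ^ i * v)"
      using cov \<epsilon> by (intro mult_left_mono) (simp_all add: D_def I_def)
    finally have "v - real (card (D \<union> E)) \<le> (1 - \<epsilon>) ^ Suc i * v" by simp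
    moreover have "(\<Union>(j, c)\<in>(SIGMA j:{l - Suc i<..l}. C' j). A j c) = D \<union> E"
      unfolding Sig UN_Un E_alt D_def ..
    moreover have "\<forall>j\<in>{l - Suc i<..l}. C' j \<subseteq> U"
      unfolding lev using CU K(1) by (auto simp: C'_def W_def)
    ultimately show ?case using eps' dis' by (intro exI[of _ C']) simp
  qed
  \<comment> \<open>For \<open>i = l\<close> the interval is \<open>{0<..l}\<close>, that is
    \<open>{1..l}\<close>.\<close>
  from this[of l] show ?thesis
    by (simp add: atLeastSucAtMost_greaterThanAtMost[symmetric])
qed

section \<open>Tilings from an approximate action of the group\<close>

theorem lemma4p5:
  fixes G :: "('g, 'm) monoid_scheme" and \<tau> \<eta> :: real
  assumes "group G" and "countable (carrier G)"
    and "0 \<le> \<tau>" and "\<tau> < 1" and "0 < \<eta>" and "\<eta> < 1"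
  shows "\<exists>(l::nat) (\<eta>'::real) (\<eta>''::real). l \<ge> 1 \<and> \<eta>' > 0 \<and> \<eta>'' > 0 \<and>
    (\<forall>Fs :: nat \<Rightarrow> 'g set.
       (\<forall>k\<in>{1..l}. finite (Fs k) \<and> Fs k \<subseteq> carrier G) \<longrightarrow>
       \<one>\<^bsub>G\<^esub> \<in> Fs 1 \<longrightarrow>
       (\<forall>k\<in>{2..l}. Fs (k - 1) \<subseteq> Fs k) \<longrightarrow>
       (\<forall>k\<in>{2..l}. real (card ((set_inv\<^bsub>G\<^esub> (Fs (k - 1)) <#>\<^bsub>G\<^esub> Fs k) - Fs k))
                     \<le> \<eta>' * real (card (Fs k))) \<longrightarrow>
       (\<exists>F. finite F \<and> F \<subseteq> carrier G \<and> \<one>\<^bsub>G\<^esub> \<in> F \<and>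
         (\<forall>(d::nat) (\<sigma> :: 'g \<Rightarrow> nat \<Rightarrow> nat) B V.
            \<sigma> \<in> carrier G \<rightarrow> carrier (sym_group d) \<longrightarrow>
            B \<subseteq> {1..d} \<longrightarrow> real (card B) \<ge> (1 - \<eta>'') * real d \<longrightarrow>
            (\<forall>a\<in>B. (\<forall>s\<in>F. \<forall>t\<in>F. \<sigma> (s \<otimes>\<^bsub>G\<^esub> t) a = \<sigma> s (\<sigma> t a)) \<and>
                    (\<forall>s\<in>F. \<forall>s'\<in>F. s \<noteq> s' \<longrightarrow> \<sigma> s a \<noteq> \<sigma> s' a) \<and>
                    \<sigma> \<one>\<^bsub>G\<^esub> a = a) \<longrightarrow>
            V \<subseteq> {1..d} \<longrightarrow> real (card V) \<ge> (1 - \<tau>) * real d \<longrightarrow>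
            (\<exists>C :: nat \<Rightarrow> nat set.
               (\<forall>k\<in>{1..l}. C k \<subseteq> V) \<and>
               (\<forall>k\<in>{1..l}. \<forall>c\<in>C k.
                  bij_betw (\<lambda>s. \<sigma> s c) (Fs k) (img_pt \<sigma> (Fs k) c)) \<and>
               disjoint_family_on (\<lambda>k. img_set \<sigma> (Fs k) (C k)) {1..l} \<and>
               eps_disjoint d \<eta> (SIGMA k:{1..l}. C k) (\<lambda>(k, c). img_pt \<sigma> (Fs k) c) \<and>
               delta_covers d (1 - \<tau> - \<eta>) (SIGMA k:{1..l}. C k)
                 (\<lambda>(k, c). img_pt \<sigma> (Fs k) c)))))"
proof -
  interpret group G by fact
  \<comment> \<open>The allowed loss \<open>\<eta> * d\<close> is split into quarters: one for the
    geometric factor \<open>(1 - \<eta>) ^ l\<close>, one for boundary effects, one for the points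
    outside \<open>B\<close>; the fourth is slack.\<close>
  obtain l0 where l0: "(1 - \<eta>) ^ l0 < \<eta> / 4"
    using real_arch_pow_inv[of "\<eta> / 4" "1 - \<eta>"] assms(5,6) by auto
  define l where "l = Suc l0"
  have l: "(1 - \<eta>) ^ l \<le> \<eta> / 4"
    using l0 assms(5,6) power_decreasing[of l0 l "1 - \<eta>"] unfolding l_def by linarith
  \<comment> \<open>The factor \<open>1 - \<eta>\<close> cancels the denominator of the boundary
    loss \<open>\<eta>' * d / (1 - \<eta>)\<close>, leaving \<open>\<eta> / 4 * d\<close>.\<close>
  define \<eta>' where "\<eta>' = \<eta> * (1 - \<eta>) / 4"
  define \<eta>'' where "\<eta>'' = \<eta> / 4"
  have pos: "\<eta>' > 0" "\<eta>'' > 0" "l \<ge> 1" using assms by (auto simp: \<eta>'_def \<eta>''_def l_def)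
  show ?thesis
  proof (rule exI[of _ l], rule exI[of _ \<eta>'], rule exI[of _ \<eta>''], intro conjI pos allI impI)
    fix Fs :: "nat \<Rightarrow> 'g set"
    assume Fs: "\<forall>k\<in>{1..l}. finite (Fs k) \<and> Fs k \<subseteq> carrier G" and one: "\<one>\<^bsub>G\<^esub> \<in> Fs 1"
      and inc: "\<forall>k\<in>{2..l}. Fs (k - 1) \<subseteq> Fs k"
      and almost_inv: "\<forall>k\<in>{2..l}. real (card ((set_inv\<^bsub>G\<^esub> (Fs (k - 1)) <#>\<^bsub>G\<^esub> Fs k) - Fs k))
                     \<le> \<eta>' * real (card (Fs k))"
    have mono: "1 \<le> k \<Longrightarrow> k \<le> j \<Longrightarrow> j \<le> l \<Longrightarrow> Fs k \<subseteq> Fs j" for k j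
    proof (induction j)
      case (Suc j)
      then show ?case using inc[rule_format, of "Suc j"] by (cases "k = Suc j") auto
    qed simp
    have ne: "\<one>\<^bsub>G\<^esub> \<in> Fs k" if "k \<in> {1..l}" for k using mono[of 1 k] that one by auto
    \<comment> \<open>Inverses are included because an identity
      \<open>\<sigma> s c = \<sigma> t b\<close> between tile points has to be solved for
      \<open>c\<close> by applying \<open>\<sigma>\<close> at the inverse of
      \<open>s\<close>.\<close>
    define F where "F = (\<Union>k\<in>{1..l}. Fs k) \<union> (\<lambda>x. inv\<^bsub>G\<^esub> x) ` (\<Union>k\<in>{1..l}. Fs k)"
    have FsF: "s \<in> F" "inv\<^bsub>G\<^esub> s \<in> F" "s \<in> carrier G" if "s \<in> Fs k" "k \<in> {1..l}" for s k
      using that Fs unfolding F_def by blast+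
    show "\<exists>F. finite F \<and> F \<subseteq> carrier G \<and> \<one>\<^bsub>G\<^esub> \<in> F \<and>
         (\<forall>(d::nat) (\<sigma> :: 'g \<Rightarrow> nat \<Rightarrow> nat) B V.
            \<sigma> \<in> carrier G \<rightarrow> carrier (sym_group d) \<longrightarrow>
            B \<subseteq> {1..d} \<longrightarrow> real (card B) \<ge> (1 - \<eta>'') * real d \<longrightarrow>
            (\<forall>a\<in>B. (\<forall>s\<in>F. \<forall>t\<in>F. \<sigma> (s \<otimes>\<^bsub>G\<^esub> t) a = \<sigma> s (\<sigma> t a)) \<and>
                    (\<forall>s\<in>F. \<forall>s'\<in>F. s \<noteq> s' \<longrightarrow> \<sigma> s a \<noteq> \<sigma> s' a) \<and>
                    \<sigma> \<one>\<^bsub>G\<^esub> a = a) \<longrightarrow>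
            V \<subseteq> {1..d} \<longrightarrow> real (card V) \<ge> (1 - \<tau>) * real d \<longrightarrow>
            (\<exists>C :: nat \<Rightarrow> nat set.
               (\<forall>k\<in>{1..l}. C k \<subseteq> V) \<and>
               (\<forall>k\<in>{1..l}. \<forall>c\<in>C k.
                  bij_betw (\<lambda>s. \<sigma> s c) (Fs k) (img_pt \<sigma> (Fs k) c)) \<and>
               disjoint_family_on (\<lambda>k. img_set \<sigma> (Fs k) (C k)) {1..l} \<and>
               eps_disjoint d \<eta> (SIGMA k:{1..l}. C k) (\<lambda>(k, c). img_pt \<sigma> (Fs k) c) \<and>
               delta_covers d (1 - \<tau> - \<eta>) (SIGMA k:{1..l}. C k)
                 (\<lambda>(k, c). img_pt \<sigma> (Fs k) c)))"
    proof (rule exI[of _ F], intro conjI allI impI)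
      show "finite F" using Fs by (auto simp: F_def)
      show "F \<subseteq> carrier G" using Fs by (auto simp: F_def)
      show "\<one>\<^bsub>G\<^esub> \<in> F" using FsF(1)[OF one] pos by auto
      fix d \<sigma> B V
      assume \<sigma>: "\<sigma> \<in> carrier G \<rightarrow> carrier (sym_group d)"
        and B: "B \<subseteq> {1..d}" "real (card B) \<ge> (1 - \<eta>'') * real d"
        and good: "\<forall>a\<in>B. (\<forall>s\<in>F. \<forall>t\<in>F. \<sigma> (s \<otimes>\<^bsub>G\<^esub> t) a = \<sigma> s (\<sigma> t a)) \<and>
                    (\<forall>s\<in>F. \<forall>s'\<in>F. s \<noteq> s' \<longrightarrow> \<sigma> s a \<noteq> \<sigma> s' a) \<and> \<sigma> \<one>\<^bsub>G\<^esub> a = a"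
        and V: "V \<subseteq> {1..d}" "real (card V) \<ge> (1 - \<tau>) * real d"
      \<comment> \<open>Centres are restricted to \<open>B\<close>, where multiplicativity and
        freeness over \<open>F\<close> hold; other points of a tile may lie outside
        \<open>B\<close>.\<close>
      define U where "U = V \<inter> B"
      define A where "A k c = img_pt \<sigma> (Fs k) c" for k c
      have A_image: "A k c = (\<lambda>s. \<sigma> s c) ` Fs k" for k c by (auto simp: A_def img_pt_def)
      have perm: "\<sigma> s permutes {1..d}" if "s \<in> carrier G" for s
        using \<sigma> that by (auto simp: sym_group_def)
      have Ud: "U \<subseteq> {1..d}" using V by (auto simp: U_def)
      then have finU: "finite U" using finite_subset by blast
      have inj: "inj_on (\<lambda>s. \<sigma> s c) (Fs k)" if "k \<in> {1..l}" "c \<in> U" for k c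
        using good that FsF(1)[of _ k] unfolding inj_on_def U_def by (metis IntD2)
      have A_card: "A k c \<subseteq> {1..d} \<and> card (A k c) = card (Fs k)" if "k \<in> {1..l}" "c \<in> U" for k c
      proof
        show "A k c \<subseteq> {1..d}"
          using permutes_in_image[OF perm] FsF(3) that Ud unfolding A_image by blast
        show "card (A k c) = card (Fs k)"
          unfolding A_image using inj[OF that] by (rule card_image)
      qed
      \<comment> \<open>Each \<open>\<sigma> s\<close> is a permutation, so for given
        \<open>y\<close> every \<open>s\<close> in \<open>Fs k\<close> accounts for at most one
        centre, the preimage of \<open>y\<close>.\<close>
      have mult: "card {c\<in>U. y \<in> A k c} \<le> card (Fs k)" if k: "k \<in> {1..l}" for k y
      proof -
        have "{c\<in>U. y \<in> A k c} \<subseteq> (\<lambda>s. inv_into UNIV (\<sigma> s) y) ` Fs k"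
        proof
          fix c assume "c \<in> {c\<in>U. y \<in> A k c}"
          then obtain s where s: "s \<in> Fs k" "y = \<sigma> s c" by (auto simp: A_image)
          then have "inv_into UNIV (\<sigma> s) y = c"
            using permutes_inverses(2)[OF perm[OF FsF(3)[OF s(1) k]]] by simp
          then show "c \<in> (\<lambda>s. inv_into UNIV (\<sigma> s) y) ` Fs k" using s by blast
        qed
        then show ?thesis using Fs k surj_card_le by blast
      qed
      have hit: "real (card ({c\<in>U. A k c \<inter> A j b \<noteq> {}} - A j b)) \<le> \<eta>' * real (card (Fs j))"
        if kj: "k \<in> {1..l}" "j \<in> {1..l}" "k < j" and b: "b \<in> U" for k j b
      proof -
        let ?N = "(set_inv\<^bsub>G\<^esub> (Fs (j - 1)) <#>\<^bsub>G\<^esub> Fs j) - Fs j"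
        have j: "j \<in> {2..l}" using kj by auto
        have "{c\<in>U. A k c \<inter> A j b \<noteq> {}} - A j b \<subseteq> (\<lambda>u. \<sigma> u b) ` ?N"
        proof
          fix c assume c: "c \<in> {c\<in>U. A k c \<inter> A j b \<noteq> {}} - A j b"
          then obtain s t where st: "s \<in> Fs k" "t \<in> Fs j" "\<sigma> s c = \<sigma> t b"
            by (auto simp: A_image)
          have cB: "c \<in> B" "b \<in> B" using c b by (auto simp: U_def)
          note s = FsF[OF st(1) kj(1)] and t = FsF[OF st(2) kj(2)]
          \<comment> \<open>Both product identities are evaluated at centres: at \<open>c\<close>
            for the product of \<open>s^-1\<close> and \<open>s\<close>, at \<open>b\<close> for
            that of \<open>s^-1\<close> and \<open>t\<close>. The tile point
            \<open>\<sigma> s c\<close> itself need not lie in \<open>B\<close>.\<close>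
          have "c = \<sigma> (inv\<^bsub>G\<^esub> s \<otimes>\<^bsub>G\<^esub> s) c" using good cB s by simp
          also have "\<dots> = \<sigma> (inv\<^bsub>G\<^esub> s) (\<sigma> t b)"
            using good cB s st(3) by metis
          also have "\<dots> = \<sigma> (inv\<^bsub>G\<^esub> s \<otimes>\<^bsub>G\<^esub> t) b" using good cB s t by simp
          finally have c_eq: "c = \<sigma> (inv\<^bsub>G\<^esub> s \<otimes>\<^bsub>G\<^esub> t) b" .
          \<comment> \<open>As \<open>k < j\<close>, nestedness moves \<open>s\<close> into
            \<open>Fs (j - 1)\<close>, so comparing consecutive shapes handles every lower level at
            once.\<close>
          have "1 \<le> k" "k \<le> j - 1" "j - 1 \<le> l" using kj by auto
          then have "s \<in> Fs (j - 1)" using mono[of k "j - 1"] st(1) by blast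
          then have "inv\<^bsub>G\<^esub> s \<otimes>\<^bsub>G\<^esub> t \<in> set_inv\<^bsub>G\<^esub> (Fs (j - 1)) <#>\<^bsub>G\<^esub> Fs j"
            using st(2) by (auto simp: set_mult_def SET_INV_def)
          \<comment> \<open>Otherwise \<open>c\<close> would lie in the tile of \<open>b\<close>,
            which has been removed.\<close>
          moreover have "inv\<^bsub>G\<^esub> s \<otimes>\<^bsub>G\<^esub> t \<notin> Fs j" using c c_eq by (auto simp: A_image)
          ultimately show "c \<in> (\<lambda>u. \<sigma> u b) ` ?N" using c_eq by blast
        qed
        moreover have "finite ?N"
        proof -
          have "j - 1 \<in> {1..l}" using j by auto
          then have "finite (Fs (j - 1))" "finite (Fs j)" using Fs kj(2) by blast+
          then show ?thesis by (auto simp: set_mult_def SET_INV_def)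
        qed
        ultimately have "card ({c\<in>U. A k c \<inter> A j b \<noteq> {}} - A j b) \<le> card ?N"
          using surj_card_le by blast
        then show ?thesis using almost_inv j by fastforce
      qed
      define v where "v = real (card U) - \<eta>' * real d / (1 - \<eta>)"
      have npos: "0 < card (Fs k)" if "k \<in> {1..l}" for k
        using ne[OF that] Fs that card_gt_0_iff by blast
      have "\<exists>C. (\<forall>k\<in>{1..l}. C k \<subseteq> U) \<and>
        disjoint_family_on (\<lambda>k. \<Union>c\<in>C k. A k c) {1..l} \<and>
        eps_disjoint d \<eta> (SIGMA k:{1..l}. C k) (\<lambda>(k, c). A k c) \<and>
        v - real (card (\<Union>(k, c)\<in>(SIGMA k:{1..l}. C k). A k c)) \<le> (1 - \<eta>) ^ l * v"
        unfolding v_def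
        by (rule ex_quasitiling[where n = "\<lambda>k. card (Fs k)"])
          (use Ud assms(5,6) pos npos A_card mult hit in auto)
      then obtain C where CU: "\<forall>k\<in>{1..l}. C k \<subseteq> U"
        and dis: "disjoint_family_on (\<lambda>k. \<Union>c\<in>C k. A k c) {1..l}"
        and eps: "eps_disjoint d \<eta> (SIGMA k:{1..l}. C k) (\<lambda>(k, c). A k c)"
        and cov: "v - real (card (\<Union>(k, c)\<in>(SIGMA k:{1..l}. C k). A k c)) \<le> (1 - \<eta>) ^ l * v"
        by blast
      \<comment> \<open>Inclusion-exclusion: cutting \<open>V\<close> down to \<open>B\<close> costs
        at most \<open>\<eta>'' * d\<close> points.\<close>
      have "card V + card B = card (V \<union> B) + card U"
        unfolding U_def using V B finite_subset by (intro card_Un_Int) blast+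
      moreover have "card (V \<union> B) \<le> card {1..d}"
        using V B by (intro card_mono) auto
      ultimately have "real (card V) + real (card B) \<le> real d + real (card U)" by simp
      then have U_ge: "real (card U) \<ge> (1 - \<tau> - \<eta> / 4) * real d"
        using V(2) B(2) by (simp add: \<eta>''_def algebra_simps)
      have v_eq: "v = real (card U) - \<eta> / 4 * real d"
        using assms(6) unfolding v_def \<eta>'_def by (simp add: field_simps)
      \<comment> \<open>The crude bound \<open>v \<le> d\<close> turns the smallness of
        \<open>(1 - \<eta>) ^ l\<close> into a loss of at most
        \<open>\<eta> / 4 * d\<close>.\<close>
      have "card U \<le> card {1..d}" using Ud by (intro card_mono) auto
      moreover have \<eta>d: "0 \<le> \<eta> * real d" using assms(5) by simp
      ultimately have "v \<le> real d" by (simp add: v_eq)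
      then have "(1 - \<eta>) ^ l * v \<le> (1 - \<eta>) ^ l * real d"
        using assms(6) by (intro mult_left_mono) auto
      also have "\<dots> \<le> \<eta> / 4 * real d" using l by (intro mult_right_mono) auto
      \<comment> \<open>The three losses are, in order, the restriction to \<open>B\<close>, the
        boundary term in \<open>v\<close>, and the deficit left after \<open>l\<close>
        levels.\<close>
      finally have "real (card (\<Union>(k, c)\<in>(SIGMA k:{1..l}. C k). A k c)) \<ge>
          (1 - \<tau> - \<eta> / 4) * real d - \<eta> / 4 * real d - \<eta> / 4 * real d"
        using cov U_ge v_eq by linarith
      then have
        "real (card (\<Union>(k, c)\<in>(SIGMA k:{1..l}. C k). A k c)) \<ge> (1 - \<tau> - \<eta>) * real d"
        using \<eta>d by (simp add: algebra_simps)
      moreover have "\<forall>p\<in>(SIGMA k:{1..l}. C k). (case p of (k, c) \<Rightarrow> A k c) \<subseteq> {1..d}"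
        using eps unfolding eps_disjoint_def by blast
      ultimately have "delta_covers d (1 - \<tau> - \<eta>) (SIGMA k:{1..l}. C k) (\<lambda>(k, c). A k c)"
        by (simp add: delta_covers_def)
      moreover have "img_set \<sigma> (Fs k) (C k) = (\<Union>c\<in>C k. A k c)" for k
        by (auto simp: A_image img_set_def)
      moreover have "bij_betw (\<lambda>s. \<sigma> s c) (Fs k) (A k c)" if "k \<in> {1..l}" "c \<in> C k" for k c
        using inj that CU unfolding A_image by (blast intro: inj_on_imp_bij_betw)
      moreover have "\<forall>k\<in>{1..l}. C k \<subseteq> V" using CU by (auto simp: U_def)
      ultimately show "\<exists>C :: nat \<Rightarrow> nat set.
               (\<forall>k\<in>{1..l}. C k \<subseteq> V) \<and>
               (\<forall>k\<in>{1..l}. \<forall>c\<in>C k.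
                  bij_betw (\<lambda>s. \<sigma> s c) (Fs k) (img_pt \<sigma> (Fs k) c)) \<and>
               disjoint_family_on (\<lambda>k. img_set \<sigma> (Fs k) (C k)) {1..l} \<and>
               eps_disjoint d \<eta> (SIGMA k:{1..l}. C k) (\<lambda>(k, c). img_pt \<sigma> (Fs k) c) \<and>
               delta_covers d (1 - \<tau> - \<eta>) (SIGMA k:{1..l}. C k)
                 (\<lambda>(k, c). img_pt \<sigma> (Fs k) c)"
        using dis eps by (intro exI[of _ C]) (simp add: A_def)
    qed
  qed
qed

end
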